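(* Consider the two-stage game between exchanges described in the context, in which every exchange is only allowed to use auctions from the class $\mathcal{C}$ of sealed-bid single-item auctions with the following properties: 1. the highest bidder always wins (this implies a zero reserve price); 2. the winner pays no more than his bid; 3. losers always pay $0$; 4. the bidders have a pure-strategy symmetric Bayes-Nash bidding equilibrium. Then the profile in which every exchange proposes the first-price auction (the highest bidder wins and pays his bid; losers pay $0$) is the unique Nash equilibrium of the game between exchanges.
   Context: There are $n$ bidders and $m$ exchanges (sellers). Bidder values $v_1,\dots,v_n\ge 0$ are drawn i.i.d. from a publicly known distribution $F$, which is differentiable on $[0,\infty)$, has no point mass, and has a continuous density $f$ that is positive on $(0,\infty)$. A query comes from exchange $j$ with probability $\lambda_j$ (the market power of exchange $j$), so $\sum_{j=1}^m\lambda_j=1$. A sealed-bid auction $\mathcal{M}=(\mathbf{x},\mathbf{p})$ maps a bid profile $\mathbf{b}=(b_1,\dots,b_n)$ to allocation probabilities $x_i(\mathbf{b})$ of a single item and non-negative payments $p_i(\mathbf{b})$. Two-stage game. Stage 1: the exchanges simultaneously propose auctions $\mathcal{M}_j=(\mathbf{x}^j,\mathbf{p}^j)\in\mathcal{C}$. Stage 2: each bidder $i$ submits a bid $\beta_i(v_i)$ depending only on his own value (the same bid regardless of which exchange the query comes from), so that bidders face the average mechanism $\sum_j\lambda_j\mathcal{M}_j$ with allocation $x_i(\mathbf{b})=\sum_j\lambda_j x_i^j(\mathbf{b})$ and payment $p_i(\mathbf{b})=\sum_j\lambda_j p^j_i(\mathbf{b})$. Bidder $i$'s utility is $x_i(\mathbf{b})v_i-p_i(\mathbf{b})$.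 The bidders play a symmetric Bayes-Nash equilibrium of the average mechanism: a common bidding function $\beta$ such that, for each bidder $i$, bidding $\beta(v_i)$ maximizes expected utility over the other bidders' values when the others use $\beta$. Standing assumption for this class: such a symmetric bidding equilibrium always exists, and every symmetric bidding equilibrium implements the same social choice function (allocation as a function of values) and charges identical interim payments. The payoff of exchange $j$ is its expected revenue $\mathrm{Rev}_j=\mathbb{E}_{\mathbf{v}}\big[\sum_i p^j_i(\beta(v_1),\dots,\beta(v_n))\big]$. A Nash equilibrium of the game between exchanges is a profile $(\mathcal{M}_1,\dots,\mathcal{M}_m)\in\mathcal{C}^m$ such that no exchange can strictly increase its own expected revenue by unilaterally proposing another auction of $\mathcal{C}$.
   Formalization: C is any class with properties 1–4 that contains first-price and meets the standing assumption (one allocation across the class); n, m ≥ 2, all λ_j > 0, revenues finite; uniqueness means each equilibrium auction agrees a.s. with first-price at first-price equilibrium bids. *)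

theory Defs
  imports "HOL-Probability.Probability"
begin

text \<open>Bidders are the elements of a finite type \<open>'i\<close>, exchanges the elements of a finite
  type \<open>'j\<close>.  Bids and values are non-negative reals, so auctions are only constrained (and only
  ever evaluated, up to null sets) at bid profiles with non-negative entries.\<close>

definition value_distribution :: "real measure \<Rightarrow> (real \<Rightarrow> real) \<Rightarrow> bool" where
  "value_distribution D f \<longleftrightarrow>
     real_distribution D \<and>
     measure D {..<0} = 0 \<and>
     (\<forall>x. measure D {x} = 0) \<and>
     (\<forall>x\<ge>0. (cdf D has_real_derivative f x) (at x within {0..})) \<and>
     continuous_on {0..} f \<and>
     (\<forall>x>0. 0 < f x)"

text \<open>\<open>pay M b i\<close> is the expected payment of bidder \<open>i\<close> over the auction's own lottery
  (needed only to break ties), just as \<open>alloc M b i\<close> is the probability that \<open>i\<close> gets the item.\<close>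

record 'i auction =
  alloc :: "('i \<Rightarrow> real) \<Rightarrow> 'i \<Rightarrow> real"
  pay :: "('i \<Rightarrow> real) \<Rightarrow> 'i \<Rightarrow> real"

definition bid_profiles :: "('i \<Rightarrow> real) set" where
  "bid_profiles = {b. \<forall>i. 0 \<le> b i}"

definition single_item_auction :: "('i::finite) auction \<Rightarrow> bool" where
  "single_item_auction M \<longleftrightarrow>
     (\<forall>i. (\<lambda>b. alloc M b i) \<in> borel_measurable (PiM UNIV (\<lambda>_. borel))) \<and>
     (\<forall>i. (\<lambda>b. pay M b i) \<in> borel_measurable (PiM UNIV (\<lambda>_. borel))) \<and>
     (\<forall>b\<in>bid_profiles. (\<forall>i. 0 \<le> alloc M b i \<and> 0 \<le> pay M b i) \<and> (\<Sum>i\<in>UNIV. alloc M b i) \<le> 1)"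

text \<open>The item is always sold, and only to a bidder with the highest bid; ties may be broken
  arbitrarily.\<close>

definition highest_bidder_wins :: "('i::finite) auction \<Rightarrow> bool" where
  "highest_bidder_wins M \<longleftrightarrow>
     (\<forall>b\<in>bid_profiles. (\<Sum>i\<in>UNIV. alloc M b i) = 1 \<and>
        (\<forall>i. 0 < alloc M b i \<longrightarrow> (\<forall>k. b k \<le> b i)))"

text \<open>Conditionally on winning, the payment of \<open>i\<close> is \<open>pay M b i / alloc M b i\<close>, since losers
  pay nothing.\<close>

definition winner_pays_at_most_bid :: "('i::finite) auction \<Rightarrow> bool" where
  "winner_pays_at_most_bid M \<longleftrightarrow>
     (\<forall>b\<in>bid_profiles. \<forall>i. pay M b i \<le> alloc M b i * b i)"

definition losers_pay_nothing :: "('i::finite) auction \<Rightarrow> bool" where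
  "losers_pay_nothing M \<longleftrightarrow> (\<forall>b\<in>bid_profiles. \<forall>i. alloc M b i = 0 \<longrightarrow> pay M b i = 0)"

definition first_price :: "('i::finite) auction" where
  "first_price =
     (let x = (\<lambda>b i. if b i = Max (range b) then 1 / real (card {k. b k = Max (range b)}) else 0)
      in \<lparr>alloc = x, pay = (\<lambda>b i. x b i * b i)\<rparr>)"

definition average :: "('j::finite \<Rightarrow> real) \<Rightarrow> ('j \<Rightarrow> 'i auction) \<Rightarrow> 'i auction" where
  "average lam M =
     \<lparr>alloc = (\<lambda>b i. \<Sum>j\<in>UNIV. lam j * alloc (M j) b i),
      pay = (\<lambda>b i. \<Sum>j\<in>UNIV. lam j * pay (M j) b i)\<rparr>"

abbreviation value_profiles :: "real measure \<Rightarrow> ('i::finite \<Rightarrow> real) measure" where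
  "value_profiles D \<equiv> PiM UNIV (\<lambda>_. D)"

text \<open>Utility of bidder \<open>i\<close> with value \<open>v\<close> who bids \<open>c\<close> while the others use \<open>\<beta>\<close>.  The
  \<open>i\<close>-th coordinate of the integration variable is irrelevant.\<close>

definition interim_utility ::
  "real measure \<Rightarrow> ('i::finite) auction \<Rightarrow> (real \<Rightarrow> real) \<Rightarrow> 'i \<Rightarrow> real \<Rightarrow> real \<Rightarrow> real" where
  "interim_utility D M \<beta> i v c =
     (\<integral>w. alloc M ((\<beta> \<circ> w)(i := c)) i * v - pay M ((\<beta> \<circ> w)(i := c)) i \<partial>value_profiles D)"

definition symmetric_BNE :: "real measure \<Rightarrow> ('i::finite) auction \<Rightarrow> (real \<Rightarrow> real) \<Rightarrow> bool" where
  "symmetric_BNE D M \<beta> \<longleftrightarrow>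
     \<beta> \<in> borel_measurable borel \<and> (\<forall>v\<ge>0. 0 \<le> \<beta> v) \<and>
     (\<forall>i. \<forall>v\<ge>0. \<forall>c\<ge>0. interim_utility D M \<beta> i v c \<le> interim_utility D M \<beta> i v (\<beta> v))"

definition admissible_auctions :: "real measure \<Rightarrow> ('i::finite) auction set" where
  "admissible_auctions D =
     {M. single_item_auction M \<and> highest_bidder_wins M \<and> winner_pays_at_most_bid M \<and>
         losers_pay_nothing M \<and> (\<exists>\<beta>. symmetric_BNE D M \<beta>)}"

text \<open>The standing assumption on the class: every average mechanism has a symmetric bidding
  equilibrium, and all symmetric bidding equilibria arising in the class implement one and the same
  social choice function (up to null sets of value profiles, e.g. ties).  Revenue equivalence of
  these equilibria, i.e. equality of interim payments, is a consequence and is not assumed.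

  Averaging need not preserve existence, nor do all equilibria have to be efficient, if arbitrary
  admissible auctions are put together: a payment rule may jump in the winning bid, which can
  create pooling or destroy the equilibrium of an average.  The assumption is therefore made about
  a class \<open>C\<close> of admissible auctions, not about \<open>admissible_auctions D\<close> itself, of which it
  would be false.\<close>

definition well_behaved_class ::
  "real measure \<Rightarrow> ('j::finite \<Rightarrow> real) \<Rightarrow> ('i::finite) auction set \<Rightarrow> bool" where
  "well_behaved_class D lam C \<longleftrightarrow>
     (\<forall>M. range M \<subseteq> C \<longrightarrow> (\<exists>\<beta>. symmetric_BNE D (average lam M) \<beta>)) \<and>
     (\<forall>M M' \<beta> \<beta>'. range M \<subseteq> C \<and> range M' \<subseteq> C \<and>
        symmetric_BNE D (average lam M) \<beta> \<and> symmetric_BNE D (average lam M') \<beta>' \<longrightarrow>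
        (AE v in value_profiles D. alloc (average lam M) (\<beta> \<circ> v) = alloc (average lam M') (\<beta>' \<circ> v)))"

text \<open>\<open>\<sigma>\<close> selects the bidding equilibrium that the bidders play after each profile of proposals.\<close>

definition bidding_play ::
  "real measure \<Rightarrow> ('j::finite \<Rightarrow> real) \<Rightarrow> ('i::finite) auction set \<Rightarrow>
     (('j \<Rightarrow> 'i auction) \<Rightarrow> real \<Rightarrow> real) \<Rightarrow> bool" where
  "bidding_play D lam C \<sigma> \<longleftrightarrow>
     (\<forall>M. range M \<subseteq> C \<longrightarrow> symmetric_BNE D (average lam M) (\<sigma> M))"

definition revenue :: "real measure \<Rightarrow> ('i::finite) auction \<Rightarrow> (real \<Rightarrow> real) \<Rightarrow> ennreal" where
  "revenue D M \<beta> = (\<integral>\<^sup>+v. ennreal (\<Sum>i\<in>UNIV. pay M (\<beta> \<circ> v) i) \<partial>value_profiles D)"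

definition exchange_NE ::
  "real measure \<Rightarrow> ('i::finite) auction set \<Rightarrow> (('j::finite \<Rightarrow> 'i auction) \<Rightarrow> real \<Rightarrow> real) \<Rightarrow>
     ('j \<Rightarrow> 'i auction) \<Rightarrow> bool" where
  "exchange_NE D C \<sigma> M \<longleftrightarrow>
     range M \<subseteq> C \<and>
     (\<forall>j. \<forall>N\<in>C. \<not> revenue D (M j) (\<sigma> M) < revenue D N (\<sigma> (M(j := N))))"

text \<open>Literal equality with \<open>first_price\<close> cannot be expected of an equilibrium auction: it may
  differ on ties, on null sets of bids, or at bids far above those submitted in the first-price
  auction.  Auctions are therefore identified when they agree almost surely at the equilibrium bids
  of the first-price auction.\<close>

definition is_first_price_ae :: "real measure \<Rightarrow> ('i::finite) auction \<Rightarrow> bool" where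
  "is_first_price_ae D M \<longleftrightarrow>
     (\<forall>\<beta>. symmetric_BNE D (first_price :: 'i auction) \<beta> \<longrightarrow>
        (AE v in value_profiles D. alloc M (\<beta> \<circ> v) = alloc first_price (\<beta> \<circ> v) \<and>
                           pay M (\<beta> \<circ> v) = pay first_price (\<beta> \<circ> v)))"

end

theory Submission
  imports Defs
begin

text \<open>The bidding equilibria of all average mechanisms implement the same allocation, and a zero bid
  costs nothing, so by revenue equivalence the revenues of the exchanges have the same weighted average
  \<open>T\<close> for every profile of proposals. Since all exchanges face the same bids and
  no auction of the class extracts more than the highest bid, a first-price exchange earns at least as
  much as any other. Hence deviating from the all-first-price profile yields at most \<open>T\<close>,
  and proposing first-price always secures \<open>T\<close>.

  In a Nash equilibrium all exchanges therefore earn exactly \<open>T\<close>, and they still do after one of them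
  switches to first-price. Then all other exchanges also collect the highest bid almost surely. Hence the
  interim payment of a bidder is his bid times his winning probability, as in the first-price auction, and
  revenue equivalence shows that the bids are those of the first-price auction. These have
  no atoms, so the allocations agree as well.\<close>

section \<open>Interim allocation and payment\<close>

definition interim_alloc ::
  "real measure \<Rightarrow> ('i::finite) auction \<Rightarrow> (real \<Rightarrow> real) \<Rightarrow> 'i \<Rightarrow> real \<Rightarrow> real" where
  "interim_alloc D M \<beta> i c = (\<integral>w. alloc M ((\<beta> \<circ> w)(i := c)) i \<partial>value_profiles D)"

definition interim_pay ::
  "real measure \<Rightarrow> ('i::finite) auction \<Rightarrow> (real \<Rightarrow> real) \<Rightarrow> 'i \<Rightarrow> real \<Rightarrow> real" where
  "interim_pay D M \<beta> i c = (\<integral>w. pay M ((\<beta> \<circ> w)(i := c)) i \<partial>value_profiles D)"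

lemma single_item_auctionD:
  assumes "single_item_auction M"
  shows "(\<lambda>b. alloc M b i) \<in> borel_measurable (PiM UNIV (\<lambda>_. borel))"
    and "(\<lambda>b. pay M b i) \<in> borel_measurable (PiM UNIV (\<lambda>_. borel))"
    and "b \<in> bid_profiles \<Longrightarrow> 0 \<le> alloc M b i"
    and "b \<in> bid_profiles \<Longrightarrow> alloc M b i \<le> 1"
    and "b \<in> bid_profiles \<Longrightarrow> 0 \<le> pay M b i"
proof -
  assume b: "b \<in> bid_profiles"
  have "alloc M b i \<le> (\<Sum>i\<in>UNIV. alloc M b i)"
    using assms b by (intro member_le_sum) (auto simp: single_item_auction_def)
  then show "alloc M b i \<le> 1"
    using assms b unfolding single_item_auction_def by (metis order_trans)
qed (use assms in \<open>auto simp: single_item_auction_def\<close>)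

lemma winner_pays_at_most_bidD:
  "winner_pays_at_most_bid M \<Longrightarrow> b \<in> bid_profiles \<Longrightarrow> pay M b i \<le> alloc M b i * b i"
  by (simp add: winner_pays_at_most_bid_def)

section \<open>Independent values and resampling of one coordinate\<close>

text \<open>\<open>interval_pos\<close> expresses full support on the half-line. It turns an almost
  sure property into one that holds somewhere in every interval, which is the form required by
  \<open>subgradient_le\<close>.\<close>

locale bidder_values = real_distribution D for D :: "real measure" +
  assumes values_nonneg: "AE t in D. 0 \<le> t"
    and no_atoms: "measure D {x} = 0"
    and interval_pos: "0 \<le> s \<Longrightarrow> s < t \<Longrightarrow> 0 < measure D {s<..t}"
begin

lemma sets_value_profiles [measurable_cong]:
  "sets (value_profiles D :: ('i::finite \<Rightarrow> real) measure) = sets (PiM UNIV (\<lambda>_. borel))"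
  by (rule sets_PiM_cong) auto

lemma prob_space_value_profiles: "prob_space (value_profiles D :: ('i::finite \<Rightarrow> real) measure)"
  by (intro prob_space_PiM prob_space_axioms)

lemma space_value_profiles [simp]: "space (value_profiles D :: ('i::finite \<Rightarrow> real) measure) = UNIV"
  by (simp add: space_PiM)

lemma pair_sigma_finite_value_profiles:
  "pair_sigma_finite D (value_profiles D :: ('i::finite \<Rightarrow> real) measure)"
  using prob_space_imp_sigma_finite[OF prob_space_value_profiles]
  by (simp add: pair_sigma_finite_def sigma_finite_measure_axioms)

text \<open>Replacing one coordinate by an independent draw preserves a product measure. This is the
  bridge between ex ante statements about value profiles and interim statements, in which the value
  of bidder \<open>i\<close> is fixed.\<close>

lemma value_profiles_resample:
  fixes i :: "'i::finite"
  shows "distr (D \<Otimes>\<^sub>M value_profiles D) (value_profiles D) (\<lambda>(t, w). w(i := t)) = value_profiles D"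
  using distr_pair_PiM_eq_PiM[of UNIV "\<lambda>_. D" i] prob_space_axioms by simp

lemma measurable_resample [measurable]:
  fixes i :: "'i::finite"
  shows "(\<lambda>(t, w). w(i := t)) \<in> D \<Otimes>\<^sub>M value_profiles D \<rightarrow>\<^sub>M value_profiles D"
  using measurable_fun_upd[where I=UNIV and J=UNIV and M="\<lambda>_. D" and i=i]
  by (auto simp: split_beta')

lemma AE_resample:
  fixes i :: "'i::finite"
  assumes "AE v in value_profiles D. P v"
  shows "AE t in D. AE w in value_profiles D. P (w(i := t))"
proof -
  interpret pair_sigma_finite D "value_profiles D :: ('i \<Rightarrow> real) measure"
    by (rule pair_sigma_finite_value_profiles)
  have "AE x in D \<Otimes>\<^sub>M value_profiles D. P ((\<lambda>(t, w). w(i := t)) x)"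
    using assms by (intro AE_distrD[OF measurable_resample]) (subst value_profiles_resample)
  from AE_pair[OF this] show ?thesis by simp
qed

text \<open>The converse of \<open>AE_resample\<close>. Passing from iterated null sets back to the
  product is Fubini's theorem for the exceptional set, hence the measurability of
  \<open>P\<close>.\<close>

lemma AE_resampleD:
  fixes i :: "'i::finite"
  assumes [measurable]: "Measurable.pred (value_profiles D) P"
    and "AE t in D. AE w in value_profiles D. P (w(i := t))"
  shows "AE v in value_profiles D. P v"
proof -
  interpret pair_sigma_finite D "value_profiles D :: ('i \<Rightarrow> real) measure"
    by (rule pair_sigma_finite_value_profiles)
  have "Measurable.pred (D \<Otimes>\<^sub>M value_profiles D) (\<lambda>x. P ((\<lambda>(t, w). w(i := t)) x))"
    by measurable
  then have "AE x in D \<Otimes>\<^sub>M value_profiles D. P ((\<lambda>(t, w). w(i := t)) x)"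
    using assms(2) by (subst (asm) AE_pair_iff) (auto simp: split_beta' pred_def)
  then show ?thesis
    by (subst value_profiles_resample[of i, symmetric], subst AE_distr_iff) (use assms(1) in \<open>auto simp: pred_def\<close>)
qed

lemma nn_integral_resample:
  fixes i :: "'i::finite"
  assumes [measurable]: "g \<in> borel_measurable (value_profiles D)"
  shows "(\<integral>\<^sup>+v. g v \<partial>value_profiles D) = (\<integral>\<^sup>+t. \<integral>\<^sup>+w. g (w(i := t)) \<partial>value_profiles D \<partial>D)"
proof -
  interpret pair_sigma_finite D "value_profiles D :: ('i \<Rightarrow> real) measure"
    by (rule pair_sigma_finite_value_profiles)
  have "(\<integral>\<^sup>+v. g v \<partial>value_profiles D) =
      (\<integral>\<^sup>+x. g ((\<lambda>(t, w). w(i := t)) x) \<partial>(D \<Otimes>\<^sub>M value_profiles D))"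
    by (subst value_profiles_resample[of i, symmetric], subst nn_integral_distr) auto
  then show ?thesis
    by (subst (asm) M2.nn_integral_fst[symmetric]) (auto simp: split_beta')
qed

lemma AE_component:
  "AE t in D. P t \<Longrightarrow> AE v in value_profiles D. P (v (i::'i::finite))"
  by (rule AE_PiM_component) (auto intro: prob_space_axioms)

lemma AE_all_components:
  assumes "AE t in D. P t"
  shows "AE v in value_profiles D. \<forall>i::'i::finite. P (v i)"
  unfolding AE_all_countable using AE_component[OF assms] by blast

lemma sets_all_components [measurable]:
  assumes [measurable]: "A \<in> sets borel"
  shows "{v. \<forall>i::'i::finite. v i \<in> A} \<in> sets (value_profiles D)"
proof -
  have "{v \<in> space (value_profiles D). \<forall>i::'i. v i \<in> A} \<in> sets (value_profiles D)"
    by measurable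
  then show ?thesis by simp
qed

lemma measure_all_components:
  assumes "A \<in> sets borel"
  shows "measure (value_profiles D) {v. \<forall>i::'i::finite. v i \<in> A} = measure D A ^ CARD('i)"
proof -
  interpret finite_product_prob_space "\<lambda>_::'i. D" UNIV
    by (unfold_locales) auto
  have "{v. \<forall>i::'i. v i \<in> A} = (\<Pi>\<^sub>E i\<in>UNIV. A)" by auto
  then show ?thesis using assms by (simp add: finite_measure_PiM_emb)
qed

lemma measurable_bids [measurable]:
  assumes [measurable]: "\<beta> \<in> borel_measurable borel"
  shows "(\<lambda>w. \<beta> \<circ> w) \<in> value_profiles D \<rightarrow>\<^sub>M PiM (UNIV :: 'i::finite set) (\<lambda>_. borel)"
  unfolding comp_def by (rule measurable_PiM_single') auto

lemma measurable_bids_upd [measurable]: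
  assumes [measurable]: "\<beta> \<in> borel_measurable borel"
  shows "(\<lambda>w. (\<beta> \<circ> w)(i := c)) \<in> value_profiles D \<rightarrow>\<^sub>M PiM (UNIV :: 'i::finite set) (\<lambda>_. borel)"
  unfolding comp_def fun_upd_def by (rule measurable_PiM_single') auto

lemma AE_bid_profiles:
  assumes "\<forall>v\<ge>0. 0 \<le> \<beta> v"
  shows "AE w in value_profiles D. \<beta> \<circ> w \<in> (bid_profiles :: ('i::finite \<Rightarrow> real) set)"
  using AE_all_components[OF values_nonneg]
  by eventually_elim (use assms in \<open>auto simp: bid_profiles_def\<close>)

lemma AE_bid_profiles_upd:
  assumes "\<forall>v\<ge>0. 0 \<le> \<beta> v" "0 \<le> c"
  shows "AE w in value_profiles D. (\<beta> \<circ> w)(i := c) \<in> (bid_profiles :: ('i::finite \<Rightarrow> real) set)"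
  using AE_bid_profiles[OF assms(1)]
  by eventually_elim (use assms(2) in \<open>auto simp: bid_profiles_def\<close>)

lemma measurable_alloc_pay:
  fixes M :: "'i::finite auction"
  assumes "single_item_auction M" and [measurable]: "\<beta> \<in> borel_measurable borel"
  shows measurable_alloc: "(\<lambda>v. alloc M (\<beta> \<circ> v) i) \<in> borel_measurable (value_profiles D)"
    and measurable_pay: "(\<lambda>v. pay M (\<beta> \<circ> v) i) \<in> borel_measurable (value_profiles D)"
    and measurable_alloc_upd:
      "(\<lambda>v. alloc M ((\<beta> \<circ> v)(i := c)) i) \<in> borel_measurable (value_profiles D)"
    and measurable_pay_upd:
      "(\<lambda>v. pay M ((\<beta> \<circ> v)(i := c)) i) \<in> borel_measurable (value_profiles D)"
  using single_item_auctionD(1,2)[OF assms(1), of i]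
  by (auto intro: measurable_compose[OF measurable_bids] measurable_compose[OF measurable_bids_upd])

end

section \<open>Interim quantities under arbitrary bidding functions\<close>

locale bidding = bidder_values +
  fixes M :: "'i::finite auction" and \<beta> :: "real \<Rightarrow> real"
  assumes single_item: "single_item_auction M"
    and pays_at_most_bid: "winner_pays_at_most_bid M"
    and bid_measurable [measurable]: "\<beta> \<in> borel_measurable borel"
    and bids_nonneg: "\<forall>v\<ge>0. 0 \<le> \<beta> v"
begin

lemma bid_nonneg: "0 \<le> v \<Longrightarrow> 0 \<le> \<beta> v"
  using bids_nonneg by simp

abbreviation "X \<equiv> interim_alloc D M \<beta>"
abbreviation "P \<equiv> interim_pay D M \<beta>"

text \<open>These bounds are only almost sure: auctions are constrained on
  \<open>bid_profiles\<close>, and the values of the opponents are nonnegative only up to a null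
  set.\<close>

lemma AE_alloc_pay_upd_bounds:
  assumes "0 \<le> c"
  shows "AE w in value_profiles D. 0 \<le> alloc M ((\<beta> \<circ> w)(i := c)) i \<and>
    alloc M ((\<beta> \<circ> w)(i := c)) i \<le> 1 \<and> 0 \<le> pay M ((\<beta> \<circ> w)(i := c)) i \<and>
    pay M ((\<beta> \<circ> w)(i := c)) i \<le> alloc M ((\<beta> \<circ> w)(i := c)) i * c"
  using AE_bid_profiles_upd[OF bids_nonneg assms, where i=i]
proof eventually_elim
  case (elim w)
  then show ?case
    using single_item_auctionD(3-5)[OF single_item elim, of i]
      winner_pays_at_most_bidD[OF pays_at_most_bid elim, of i] by auto
qed

lemma integrable_alloc_upd:
  assumes "0 \<le> c"
  shows "integrable (value_profiles D) (\<lambda>w. alloc M ((\<beta> \<circ> w)(i := c)) i)"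
proof -
  interpret V: prob_space "value_profiles D :: ('i \<Rightarrow> real) measure"
    by (rule prob_space_value_profiles)
  show ?thesis
  proof (rule V.integrable_const_bound[where B=1])
    show "AE w in value_profiles D. norm (alloc M ((\<beta> \<circ> w)(i := c)) i) \<le> 1"
      using AE_alloc_pay_upd_bounds[OF assms, of i] by eventually_elim auto
  qed (rule measurable_alloc_upd[OF single_item bid_measurable])
qed

lemma integrable_pay_upd:
  assumes "0 \<le> c"
  shows "integrable (value_profiles D) (\<lambda>w. pay M ((\<beta> \<circ> w)(i := c)) i)"
proof -
  interpret V: prob_space "value_profiles D :: ('i \<Rightarrow> real) measure"
    by (rule prob_space_value_profiles)
  show ?thesis
  proof (rule V.integrable_const_bound[where B=c])
    show "AE w in value_profiles D. norm (pay M ((\<beta> \<circ> w)(i := c)) i) \<le> c"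
      using AE_alloc_pay_upd_bounds[OF assms, of i]
    proof eventually_elim
      case (elim w)
      then have "alloc M ((\<beta> \<circ> w)(i := c)) i * c \<le> 1 * c"
        using assms by (intro mult_right_mono) auto
      then show ?case using elim by auto
    qed
  qed (rule measurable_pay_upd[OF single_item bid_measurable])
qed

lemma interim_utility_eq:
  assumes "0 \<le> c"
  shows "interim_utility D M \<beta> i v c = X i c * v - P i c"
  unfolding interim_utility_def interim_alloc_def interim_pay_def
  using integrable_alloc_upd[OF assms] integrable_pay_upd[OF assms] by simp

lemma interim_bounds:
  assumes "0 \<le> c"
  shows "0 \<le> X i c" "X i c \<le> 1" "0 \<le> P i c" "P i c \<le> X i c * c"
proof -
  interpret V: prob_space "value_profiles D :: ('i \<Rightarrow> real) measure"
    by (rule prob_space_value_profiles)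
  note ae = AE_alloc_pay_upd_bounds[OF assms, of i]
  show "0 \<le> X i c" unfolding interim_alloc_def
    by (rule integral_nonneg_AE) (use ae in eventually_elim, auto)
  show "0 \<le> P i c" unfolding interim_pay_def
    by (rule integral_nonneg_AE) (use ae in eventually_elim, auto)
  show "X i c \<le> 1" unfolding interim_alloc_def
    by (rule V.integral_le_const[OF integrable_alloc_upd[OF assms]])
       (use ae in eventually_elim, auto)
  have "P i c \<le> (\<integral>w. alloc M ((\<beta> \<circ> w)(i := c)) i * c \<partial>value_profiles D)"
    unfolding interim_pay_def
    by (intro integral_mono_AE integrable_pay_upd integrable_mult_left integrable_alloc_upd assms)
       (use ae in eventually_elim, auto)
  then show "P i c \<le> X i c * c" by (simp add: interim_alloc_def)
qed

lemma resample_bids: "\<beta> \<circ> w(i := t) = (\<beta> \<circ> w)(i := \<beta> t)"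
  by auto

lemma nn_integral_pay:
  "(\<integral>\<^sup>+v. ennreal (pay M (\<beta> \<circ> v) i) \<partial>value_profiles D) = (\<integral>\<^sup>+t. ennreal (P i (\<beta> t)) \<partial>D)"
proof -
  have "(\<integral>\<^sup>+v. ennreal (pay M (\<beta> \<circ> v) i) \<partial>value_profiles D) =
      (\<integral>\<^sup>+t. \<integral>\<^sup>+w. ennreal (pay M ((\<beta> \<circ> w)(i := \<beta> t)) i) \<partial>value_profiles D \<partial>D)"
    using measurable_pay[OF single_item bid_measurable]
    by (subst nn_integral_resample[where i=i]) (auto simp: resample_bids)
  also have "\<dots> = (\<integral>\<^sup>+t. ennreal (P i (\<beta> t)) \<partial>D)"
  proof (rule nn_integral_cong_AE, use values_nonneg in eventually_elim)
    fix t :: real assume t: "0 \<le> t"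
    show "(\<integral>\<^sup>+w. ennreal (pay M ((\<beta> \<circ> w)(i := \<beta> t)) i) \<partial>value_profiles D) = ennreal (P i (\<beta> t))"
      unfolding interim_pay_def
    proof (intro nn_integral_eq_integral integrable_pay_upd bid_nonneg t)
      show "AE w in value_profiles D. 0 \<le> pay M ((\<beta> \<circ> w)(i := \<beta> t)) i"
        using AE_alloc_pay_upd_bounds[OF bid_nonneg[OF t], of i] by eventually_elim auto
    qed
  qed
  finally show ?thesis .
qed

text \<open>Revenue is thereby a function of the interim payments alone, so revenue equivalence can
  be proved bidder by bidder.\<close>

lemma revenue_eq: "revenue D M \<beta> = (\<Sum>i\<in>UNIV. \<integral>\<^sup>+t. ennreal (P i (\<beta> t)) \<partial>D)"
proof -
  have "revenue D M \<beta> = (\<integral>\<^sup>+v. (\<Sum>i\<in>UNIV. ennreal (pay M (\<beta> \<circ> v) i)) \<partial>value_profiles D)"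
    unfolding revenue_def
    by (rule nn_integral_cong_AE, use AE_bid_profiles[OF bids_nonneg] in eventually_elim)
       (auto simp: single_item_auctionD[OF single_item])
  also have "\<dots> = (\<Sum>i\<in>UNIV. \<integral>\<^sup>+v. ennreal (pay M (\<beta> \<circ> v) i) \<partial>value_profiles D)"
    by (rule nn_integral_sum) (use measurable_pay[OF single_item bid_measurable] in auto)
  finally show ?thesis by (simp add: nn_integral_pay)
qed

end

text \<open>A positive derivative makes the cdf strictly increasing on the half-line. The point 0,
  where the density may vanish, enters only as an endpoint, where continuity suffices.\<close>

lemma value_distribution_bidder_values:
  assumes "value_distribution D f"
  shows "bidder_values D"
proof -
  interpret real_distribution D
    using assms by (simp add: value_distribution_def)
  show ?thesis
  proof
    have "measure D {..<0} = 0"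
      using assms by (simp add: value_distribution_def)
    then have "{..<0} \<in> null_sets D"
      by (auto simp: null_sets_def emeasure_eq_measure)
    then show "AE t in D. 0 \<le> t"
      by (rule AE_I') auto
    show "measure D {x} = 0" for x
      using assms by (simp add: value_distribution_def)
    fix s t :: real assume st: "0 \<le> s" "s < t"
    have deriv: "(cdf D has_real_derivative f x) (at x within {0..})" if "0 \<le> x" for x
      using assms that by (simp add: value_distribution_def)
    have "cdf D s < cdf D t"
    proof (rule DERIV_pos_imp_increasing_open[OF st(2)])
      fix x assume "s < x" "x < t"
      then have "0 < x" using st by simp
      moreover from this have "at x within {0..} = at x"
        by (intro at_within_interior) (simp add: interior_Ici[of "-1"])
      ultimately show "\<exists>y. (cdf D has_real_derivative y) (at x) \<and> 0 < y"
        using deriv[of x] assms by (auto simp: value_distribution_def)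
    next
      have "continuous_on {0..} (cdf D)"
        using deriv by (intro DERIV_continuous_on) auto
      then show "continuous_on {s..t} (cdf D)"
        by (rule continuous_on_subset) (use st in auto)
    qed
    then show "0 < measure D {s<..t}"
      using cdf_diff_eq[OF st(2)] by simp
  qed
qed

section \<open>Revenue equivalence\<close>

text \<open>When \<open>u\<close> and \<open>u'\<close> are compared along an equidistant partition, the error
  terms telescope because \<open>x\<close> and \<open>x'\<close> interlace.\<close>

lemma subgradient_le:
  fixes x x' u u' :: "real \<Rightarrow> real"
  assumes ic: "\<And>s t. 0 \<le> s \<Longrightarrow> 0 \<le> t \<Longrightarrow> x s * (t - s) \<le> u t - u s"
    and ic': "\<And>s t. 0 \<le> s \<Longrightarrow> 0 \<le> t \<Longrightarrow> x' s * (t - s) \<le> u' t - u' s"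
    and x: "\<And>s. 0 \<le> s \<Longrightarrow> 0 \<le> x s" "\<And>s. 0 \<le> s \<Longrightarrow> x s \<le> 1" "\<And>s. 0 \<le> s \<Longrightarrow> 0 \<le> x' s"
    and u0: "u 0 \<le> u' 0"
    and dense: "\<And>s t. 0 \<le> s \<Longrightarrow> s < t \<Longrightarrow> \<exists>a\<in>{s<..t}. x a = x' a"
    and v: "0 \<le> v"
  shows "u v \<le> u' v"
proof -
  \<comment> \<open>Subgradients are monotone: add the inequality at \<open>s\<close> towards
    \<open>t\<close> and the one at \<open>t\<close> towards \<open>s\<close>.\<close>
  have mono: "y s \<le> y t"
    if "\<And>s t. 0 \<le> s \<Longrightarrow> 0 \<le> t \<Longrightarrow> y s * (t - s) \<le> w t - w s" "0 \<le> s" "s \<le> t"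
    for y w :: "real \<Rightarrow> real" and s t
  proof (cases "s = t")
    case False
    have "y s * (t - s) \<le> y t * (t - s)"
      using that(1)[of s t] that(1)[of t s] that(2,3) by (simp add: algebra_simps)
    then show ?thesis using False that by (simp add: mult_le_cancel_right)
  qed simp
  \<comment> \<open>Go up along \<open>x\<close> to a point where \<open>x\<close> and
    \<open>x'\<close> agree, then on along \<open>x'\<close>.\<close>
  have interlace: "x s \<le> x' t" if st: "0 \<le> s" "s < t" for s t
  proof -
    obtain a where "a \<in> {s<..t}" "x a = x' a" using dense[OF st] by blast
    then show ?thesis
      using mono[OF ic, of s a] mono[OF ic', of a t] st by auto
  qed
  \<comment> \<open>In the step from \<open>b\<close> to \<open>c\<close> the difference grows by at
    most \<open>h * (x c - x' b)\<close>, which interlacing bounds by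
    \<open>h * (x c - x a)\<close>. So the two most recent values of \<open>x\<close> are all that
    remains of the accumulated error.\<close>
  have bound: "u (h * real (Suc k)) - u' (h * real (Suc k)) \<le>
      h * (x (h * real (Suc k)) + x (h * real k))" if h: "0 < h" for h k
  proof (induction k)
    case 0
    have "0 \<le> h * x 0" "0 \<le> h * x' 0" using x(1)[of 0] x(3)[of 0] h by auto
    then show ?case
      using ic[of h 0] ic'[of 0 h] u0 h by (simp add: algebra_simps)
  next
    case (Suc k)
    define a b c where "a = h * real k" and "b = h * real (Suc k)" and "c = h * real (Suc (Suc k))"
    have abc: "0 \<le> a" "b = a + h" "c = b + h" "0 \<le> b" "0 \<le> c"
      using h by (auto simp: a_def b_def c_def algebra_simps)
    have "u c - u b \<le> h * x c" "h * x' b \<le> u' c - u' b"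
      using ic[of c b] ic'[of b c] abc by (auto simp: algebra_simps)
    moreover have "h * x a \<le> h * x' b"
      using interlace[of a b] abc h by (intro mult_left_mono) auto
    moreover have "u b - u' b \<le> h * (x b + x a)"
      using Suc.IH by (simp add: a_def b_def)
    ultimately have "u c - u' c \<le> h * (x c + x b)" by (simp add: algebra_simps)
    then show ?case by (simp add: b_def c_def)
  qed
  show ?thesis
  proof (cases "v = 0")
    case False
    with v have "0 < v" by simp
    show ?thesis
    proof (rule field_le_epsilon)
      fix e :: real assume "0 < e"
      \<comment> \<open>Since \<open>x\<close> is at most 1, the total error is at most twice the
        mesh \<open>v / Suc N\<close>; this choice of \<open>N\<close> makes it smaller than
        \<open>e\<close>.\<close>
      then obtain N where N: "2 * v / e < real (Suc N)"
        using reals_Archimedean2 less_trans of_nat_less_iff lessI by metis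
      define h where "h = v / real (Suc N)"
      have h: "0 < h" "h * real (Suc N) = v" "h * real N \<ge> 0"
        using \<open>0 < v\<close> by (auto simp: h_def)
      have "h * (x v + x (h * real N)) \<le> h * 2"
        using x(2)[OF v] x(2)[OF h(3)] h(1) by (intro mult_left_mono) auto
      moreover have "h * 2 < e"
        using N \<open>0 < e\<close> by (simp add: h_def field_simps)
      ultimately show "u v \<le> u' v + e"
        using bound[OF h(1), of N] unfolding h(2) by simp
    qed
  qed (use u0 in simp)
qed

locale equilibrium = bidding +
  assumes BNE: "symmetric_BNE D M \<beta>"
begin

abbreviation "U i v \<equiv> X i (\<beta> v) * v - P i (\<beta> v)"

lemma deviation_le:
  assumes "0 \<le> v" "0 \<le> c"
  shows "X i c * v - P i c \<le> U i v"
proof -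
  have "interim_utility D M \<beta> i v c \<le> interim_utility D M \<beta> i v (\<beta> v)"
    using BNE assms by (simp add: symmetric_BNE_def)
  then show ?thesis using assms by (simp add: interim_utility_eq bid_nonneg)
qed

text \<open>A bid of 0 costs nothing because nobody pays more than his bid, so deviating to it
  guarantees a nonnegative utility.\<close>

lemma utility_nonneg: "0 \<le> v \<Longrightarrow> 0 \<le> U i v"
proof -
  assume v: "0 \<le> v"
  have "0 \<le> X i 0 * v" using interim_bounds(1)[of 0 i] v by simp
  moreover have "P i 0 = 0" using interim_bounds(3,4)[of 0 i] by simp
  ultimately show ?thesis using deviation_le[of v 0 i] v by linarith
qed

text \<open>The boundary value that fixes the constant of integration in revenue equivalence: a
  bidder with value 0 cannot gain from the item, and payments are nonnegative.\<close>

lemma utility_zero: "U i 0 = 0"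
  using utility_nonneg[of 0 i] interim_bounds(3)[OF bid_nonneg, of 0 i] by simp

text \<open>A bidder with value \<open>t\<close> may imitate one with value \<open>s\<close>. Thus
  the interim winning probability is a subgradient of the equilibrium utility.\<close>

lemma utility_subgradient: "0 \<le> s \<Longrightarrow> 0 \<le> t \<Longrightarrow> X i (\<beta> s) * (t - s) \<le> U i t - U i s"
  using deviation_le[of t "\<beta> s" i] bid_nonneg[of s] by (simp add: algebra_simps)

end

lemma (in bidder_values) equilibriumI:
  assumes "single_item_auction M" "winner_pays_at_most_bid M" "symmetric_BNE D M \<beta>"
  shows "equilibrium D M \<beta>"
  by unfold_locales (use assms in \<open>auto simp: symmetric_BNE_def\<close>)

locale two_equilibria =
  E: equilibrium D M \<beta> + E': equilibrium D M' \<beta>'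
  for D and M M' :: "'i::finite auction" and \<beta> \<beta>' +
  assumes same_alloc: "AE v in value_profiles D. alloc M (\<beta> \<circ> v) = alloc M' (\<beta>' \<circ> v)"
begin

lemma AE_same_interim_alloc: "AE t in D. E.X i (\<beta> t) = E'.X i (\<beta>' t)"
  using E.AE_resample[OF same_alloc, of i] E.values_nonneg
proof eventually_elim
  case (elim t)
  show ?case unfolding interim_alloc_def
  proof (rule integral_cong_AE)
    show "AE w in value_profiles D.
        alloc M ((\<beta> \<circ> w)(i := \<beta> t)) i = alloc M' ((\<beta>' \<circ> w)(i := \<beta>' t)) i"
      using elim(1) by eventually_elim (simp add: E.resample_bids E'.resample_bids)
  qed (auto intro: E.measurable_alloc_upd E.single_item E'.single_item)
qed

text \<open>Both utilities vanish at 0, and their subgradients agree almost surely, hence at some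
  point of every interval. Applying \<open>subgradient_le\<close> in both directions gives equality
  at every value, not just at almost every one.\<close>

lemma same_utility:
  assumes "0 \<le> v"
  shows "E.U i v = E'.U i v"
proof -
  have dense: "\<exists>a\<in>{s<..t}. E.X i (\<beta> a) = E'.X i (\<beta>' a)" if "0 \<le> s" "s < t" for s t
  proof (rule ccontr)
    assume "\<not> ?thesis"
    then have "AE a in D. a \<notin> {s<..t}"
      using AE_same_interim_alloc[of i] by auto
    then have "measure D {s<..t} = 0"
      by (subst (asm) AE_iff_measurable[where N="{s<..t}"]) (auto simp: E.emeasure_eq_measure)
    with E.interval_pos[OF that] show False by simp
  qed
  have "E.U i v \<le> E'.U i v"
  proof (rule subgradient_le[where x="\<lambda>t. E.X i (\<beta> t)" and x'="\<lambda>t. E'.X i (\<beta>' t)"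
        and u="\<lambda>t. E.U i t" and u'="\<lambda>t. E'.U i t"])
    show "\<exists>a\<in>{s<..t}. E.X i (\<beta> a) = E'.X i (\<beta>' a)" if "0 \<le> s" "s < t" for s t
      by (rule dense[OF that])
  qed (use assms in \<open>simp_all only: E.utility_subgradient E'.utility_subgradient E.interim_bounds
      E'.interim_bounds E.bid_nonneg E'.bid_nonneg E.utility_zero E'.utility_zero order_refl\<close>)
  moreover have "E'.U i v \<le> E.U i v"
  proof (rule subgradient_le[where x="\<lambda>t. E'.X i (\<beta>' t)" and x'="\<lambda>t. E.X i (\<beta> t)"
        and u="\<lambda>t. E'.U i t" and u'="\<lambda>t. E.U i t"])
    show "\<exists>a\<in>{s<..t}. E'.X i (\<beta>' a) = E.X i (\<beta> a)" if "0 \<le> s" "s < t" for s t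
      using dense[OF that] by metis
  qed (use assms in \<open>simp_all only: E.utility_subgradient E'.utility_subgradient E.interim_bounds
      E'.interim_bounds E.bid_nonneg E'.bid_nonneg E.utility_zero E'.utility_zero order_refl\<close>)
  ultimately show ?thesis by simp
qed

lemma AE_same_interim_pay: "AE t in D. E.P i (\<beta> t) = E'.P i (\<beta>' t)"
  using AE_same_interim_alloc[of i] E.values_nonneg
  by eventually_elim (use same_utility[of _ i] in force)

lemma same_revenue: "revenue D M \<beta> = revenue D M' \<beta>'"
  unfolding E.revenue_eq E'.revenue_eq
proof (intro sum.cong refl nn_integral_cong_AE)
  show "AE t in D. ennreal (E.P i (\<beta> t)) = ennreal (E'.P i (\<beta>' t))" for i
    using AE_same_interim_pay[of i] by eventually_elim simp
qed

end

section \<open>Average mechanisms\<close>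

lemma admissible_auctionsD:
  assumes "M \<in> admissible_auctions D"
  shows "single_item_auction M" "highest_bidder_wins M" "winner_pays_at_most_bid M"
  using assms by (auto simp: admissible_auctions_def)

text \<open>Allows the first-price auction itself to be treated as the average mechanism of the
  all-first-price profile.\<close>

lemma average_const: "(\<Sum>j\<in>UNIV. lam j) = 1 \<Longrightarrow> average lam (\<lambda>_. M) = (M :: 'i auction)"
  by (simp add: average_def sum_distrib_right[symmetric])

lemma sum_alloc_average:
  "(\<Sum>i\<in>UNIV. alloc (average lam M) b i) = (\<Sum>j\<in>UNIV. lam j * (\<Sum>i\<in>UNIV. alloc (M j) b i))"
  unfolding average_def by (simp add: sum_distrib_left) (rule sum.swap)

lemma single_item_average:
  fixes M :: "'j::finite \<Rightarrow> 'i::finite auction"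
  assumes "\<And>j. single_item_auction (M j)" "\<And>j. 0 \<le> lam j" "(\<Sum>j\<in>UNIV. lam j) = 1"
  shows "single_item_auction (average lam M)"
proof -
  have "(\<Sum>i\<in>UNIV. alloc (average lam M) b i) \<le> 1" if "b \<in> bid_profiles" for b
  proof -
    have "(\<Sum>i\<in>UNIV. alloc (average lam M) b i) \<le> (\<Sum>j\<in>UNIV. lam j * 1)"
      unfolding sum_alloc_average using assms(1,2) that
      by (intro sum_mono mult_left_mono) (auto simp: single_item_auction_def)
    then show ?thesis using assms(3) by simp
  qed
  moreover have "(\<lambda>b. alloc (average lam M) b i) \<in> borel_measurable (PiM UNIV (\<lambda>_. borel))"
    "(\<lambda>b. pay (average lam M) b i) \<in> borel_measurable (PiM UNIV (\<lambda>_. borel))" for i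
    using single_item_auctionD(1,2)[OF assms(1)] by (simp_all add: average_def)
  moreover have "0 \<le> alloc (average lam M) b i" "0 \<le> pay (average lam M) b i"
    if "b \<in> bid_profiles" for b i
    using single_item_auctionD(3,5)[OF assms(1) that] assms(2)
    by (simp_all add: average_def sum_nonneg)
  ultimately show ?thesis unfolding single_item_auction_def by blast
qed

lemma winner_pays_at_most_bid_average:
  fixes M :: "'j::finite \<Rightarrow> 'i::finite auction"
  assumes "\<And>j. winner_pays_at_most_bid (M j)" "\<And>j. 0 \<le> lam j"
  shows "winner_pays_at_most_bid (average lam M)"
  using assms
  by (auto simp: winner_pays_at_most_bid_def average_def sum_distrib_right mult.assoc
      intro!: sum_mono mult_left_mono)

lemma (in bidder_values) revenue_average:
  fixes M :: "'j::finite \<Rightarrow> 'i::finite auction"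
  assumes "\<And>j. single_item_auction (M j)" "\<And>j. 0 \<le> lam j"
    and "\<beta> \<in> borel_measurable borel" "\<forall>v\<ge>0. 0 \<le> \<beta> v"
  shows "revenue D (average lam M) \<beta> = (\<Sum>j\<in>UNIV. ennreal (lam j) * revenue D (M j) \<beta>)"
proof -
  have "revenue D (average lam M) \<beta> =
      (\<integral>\<^sup>+v. (\<Sum>j\<in>UNIV. ennreal (lam j) * ennreal (\<Sum>i\<in>UNIV. pay (M j) (\<beta> \<circ> v) i)) \<partial>value_profiles D)"
    unfolding revenue_def
  proof (rule nn_integral_cong_AE, use AE_bid_profiles[OF assms(4)] in eventually_elim)
    fix v :: "'i \<Rightarrow> real" assume v: "\<beta> \<circ> v \<in> bid_profiles"
    have pay: "0 \<le> (\<Sum>i\<in>UNIV. pay (M j) (\<beta> \<circ> v) i)" for j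
      by (intro sum_nonneg single_item_auctionD(5)[OF assms(1) v])
    have "(\<Sum>i\<in>UNIV. pay (average lam M) (\<beta> \<circ> v) i) =
        (\<Sum>j\<in>UNIV. lam j * (\<Sum>i\<in>UNIV. pay (M j) (\<beta> \<circ> v) i))"
      unfolding average_def by (simp add: sum_distrib_left) (rule sum.swap)
    then show "ennreal (\<Sum>i\<in>UNIV. pay (average lam M) (\<beta> \<circ> v) i) =
        (\<Sum>j\<in>UNIV. ennreal (lam j) * ennreal (\<Sum>i\<in>UNIV. pay (M j) (\<beta> \<circ> v) i))"
      using pay assms(2) by (simp add: ennreal_mult[symmetric] sum_ennreal)
  qed
  also have "\<dots> = (\<Sum>j\<in>UNIV. ennreal (lam j) * revenue D (M j) \<beta>)"
    unfolding revenue_def using measurable_pay[OF assms(1,3)]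
    by (subst nn_integral_sum) (auto simp: nn_integral_cmult)
  finally show ?thesis .
qed

section \<open>Highest-bidder allocations and the first-price auction\<close>

text \<open>Wherever the allocation is positive, the bid equals the maximum, and the allocations sum
  to 1. The result caps what any auction of the class collects at \<open>b\<close>, and the
  first-price auction attains the cap.\<close>

lemma sum_alloc_bid_eq_Max:
  assumes "highest_bidder_wins M" "single_item_auction M" "b \<in> bid_profiles"
  shows "(\<Sum>i\<in>UNIV. alloc M b i * b i) = Max (range b)"
proof -
  have "alloc M b i * b i = alloc M b i * Max (range b)" for i
  proof (cases "alloc M b i = 0")
    case False
    then have "\<forall>k. b k \<le> b i"
      using assms single_item_auctionD(3)[OF assms(2,3), of i]
      by (auto simp: highest_bidder_wins_def order_less_le)
    then have "Max (range b) = b i" by (intro Max_eqI) auto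
    then show ?thesis by simp
  qed simp
  then have "(\<Sum>i\<in>UNIV. alloc M b i * b i) = (\<Sum>i\<in>UNIV. alloc M b i) * Max (range b)"
    unfolding sum_distrib_right by (intro sum.cong refl)
  then show ?thesis
    using assms by (simp add: highest_bidder_wins_def)
qed

lemma pay_first_price: "pay first_price b i = alloc first_price b i * b i"
  by (simp add: first_price_def Let_def)

lemma alloc_first_price:
  "alloc first_price b i =
    (if b i = Max (range b) then 1 / real (card {k. b k = Max (range b)}) else 0)"
  by (simp add: first_price_def)

lemma Max_range_eq_iff:
  fixes b :: "'i::finite \<Rightarrow> real"
  shows "b i = Max (range b) \<longleftrightarrow> (\<forall>k. b k \<le> b i)"
  by (subst eq_commute) (auto simp: Max_eq_iff)

lemma alloc_first_price_unique:
  assumes "\<And>k. k \<noteq> i \<Longrightarrow> b k < b i"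
  shows "alloc first_price b i = 1"
proof -
  have "b i = Max (range b)"
    unfolding Max_range_eq_iff using assms by (metis order_less_imp_le order_refl)
  moreover from this have "{k. b k = Max (range b)} = {i}" using assms by force
  ultimately show ?thesis unfolding alloc_first_price by simp
qed

lemma alloc_first_price_tied:
  assumes "k \<noteq> i" "b k = b i"
  shows "alloc first_price b i \<le> 1 / 2"
proof -
  have "2 \<le> card {k. b k = Max (range b)}" if "b i = Max (range b)"
    using card_mono[of "{k. b k = Max (range b)}" "{i, k}"] assms that by auto
  then show ?thesis unfolding alloc_first_price by (auto simp: field_simps)
qed

lemma alloc_first_price_highest:
  fixes b :: "'i::finite \<Rightarrow> real"
  assumes "\<And>k. b k \<le> b i"
  shows "1 / real CARD('i) \<le> alloc first_price b i"
proof -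
  have "b i = Max (range b)" unfolding Max_range_eq_iff using assms by simp
  moreover have "0 < card {k. b k = Max (range b)}" using calculation by (auto simp: card_gt_0_iff)
  moreover have "card {k. b k = Max (range b)} \<le> CARD('i)" by (rule card_mono) auto
  ultimately show ?thesis unfolding alloc_first_price by (auto intro!: divide_left_mono)
qed

lemma alloc_first_price_outbid: "b i < b k \<Longrightarrow> alloc first_price b i = 0"
  unfolding alloc_first_price Max_range_eq_iff by (auto simp: not_le[symmetric])

lemma alloc_first_price_le_1: "alloc first_price b i \<le> 1"
proof -
  have "1 / real n \<le> 1" for n by (cases n) auto
  then show ?thesis unfolding alloc_first_price by simp
qed

text \<open>Tie-breaking is the only freedom in the allocation; with distinct bids the single
  highest bidder must win with probability 1.\<close>

lemma highest_bidder_wins_alloc_unique: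
  assumes "highest_bidder_wins M" "highest_bidder_wins N" "single_item_auction M"
    "single_item_auction N" "b \<in> bid_profiles" "inj b"
  shows "alloc M b = alloc N b"
proof -
  obtain i where "b i = Max (range b)"
    using Max_in[of "range b"] by (auto simp: image_iff dest: sym)
  then have i: "b k \<le> b i" for k by (simp add: Max_range_eq_iff)
  have zero: "alloc A b k = 0" if "highest_bidder_wins A" "single_item_auction A" "k \<noteq> i" for A k
  proof (rule ccontr)
    assume "alloc A b k \<noteq> 0"
    then have "b i \<le> b k"
      using that single_item_auctionD(3)[OF that(2) assms(5), of k] assms(5)
      by (auto simp: highest_bidder_wins_def order_less_le)
    then show False using i[of k] \<open>inj b\<close> that(3) by (auto dest: injD)
  qed
  moreover have "alloc A b i = 1" if "highest_bidder_wins A" "single_item_auction A" for A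
  proof -
    have "(\<Sum>k\<in>UNIV. alloc A b k) = alloc A b i"
      using zero[OF that] by (subst sum.remove[of _ i]) auto
    then show ?thesis using that(1) assms(5) by (simp add: highest_bidder_wins_def)
  qed
  ultimately show ?thesis using assms(1-4) by (intro ext) metis
qed

section \<open>First-price revenue as an upper bound\<close>

context bidder_values
begin

text \<open>The bids are arbitrary here because in the game they come from an equilibrium of an
  average mechanism, not of \<open>N\<close> or of \<open>first_price\<close>.\<close>

context
  fixes N :: "'i::finite auction" and \<beta> :: "real \<Rightarrow> real"
  assumes N: "single_item_auction N" "highest_bidder_wins N" "winner_pays_at_most_bid N"
    and fp: "single_item_auction (first_price :: 'i auction)"
      "highest_bidder_wins (first_price :: 'i auction)"
    and \<beta>: "\<beta> \<in> borel_measurable borel" "\<forall>v\<ge>0. 0 \<le> \<beta> v"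
begin

lemma AE_revenue_le_first_price:
  "AE v in value_profiles D.
    (\<Sum>i\<in>UNIV. pay N (\<beta> \<circ> v) i) \<le> (\<Sum>i\<in>UNIV. pay (first_price :: 'i auction) (\<beta> \<circ> v) i)"
  using AE_bid_profiles[OF \<beta>(2)]
proof eventually_elim
  case (elim v)
  have "(\<Sum>i\<in>UNIV. pay N (\<beta> \<circ> v) i) \<le> (\<Sum>i\<in>UNIV. alloc N (\<beta> \<circ> v) i * (\<beta> \<circ> v) i)"
    by (intro sum_mono winner_pays_at_most_bidD N elim)
  then show ?case
    using sum_alloc_bid_eq_Max[OF N(2,1) elim] sum_alloc_bid_eq_Max[OF fp(2,1) elim]
    by (simp add: pay_first_price)
qed

lemma revenue_le_first_price: "revenue D N \<beta> \<le> revenue D (first_price :: 'i auction) \<beta>"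
  unfolding revenue_def
proof (rule nn_integral_mono_AE)
  show "AE v in value_profiles D. ennreal (\<Sum>i\<in>UNIV. pay N (\<beta> \<circ> v) i) \<le>
      ennreal (\<Sum>i\<in>UNIV. pay (first_price :: 'i auction) (\<beta> \<circ> v) i)"
    using AE_revenue_le_first_price by eventually_elim (rule ennreal_leI)
qed

text \<open>The pointwise revenue gap is nonnegative and, by finiteness, its integral is the
  difference of the revenues, namely 0. So the gap vanishes almost surely, and so does each of the
  nonnegative individual gaps of which it is the sum.\<close>

lemma AE_pay_eq_bid_if_revenue_eq:
  assumes eq: "revenue D N \<beta> = revenue D (first_price :: 'i auction) \<beta>" and fin: "revenue D N \<beta> < \<infinity>"
  shows "AE v in value_profiles D. \<forall>i. pay N (\<beta> \<circ> v) i = alloc N (\<beta> \<circ> v) i * \<beta> (v i)"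
proof -
  let ?F = "\<lambda>v. ennreal (\<Sum>i\<in>UNIV. pay (first_price :: 'i auction) (\<beta> \<circ> v) i)"
  let ?G = "\<lambda>v. ennreal (\<Sum>i\<in>UNIV. pay N (\<beta> \<circ> v) i)"
  have [measurable]: "?F \<in> borel_measurable (value_profiles D)" "?G \<in> borel_measurable (value_profiles D)"
    by (intro measurable_compose[OF _ measurable_ennreal] borel_measurable_sum
        measurable_pay fp N \<beta>)+
  have "(\<integral>\<^sup>+v. ?F v - ?G v \<partial>value_profiles D) = revenue D (first_price :: 'i auction) \<beta> - revenue D N \<beta>"
    unfolding revenue_def
  proof (rule nn_integral_diff)
    show "AE v in value_profiles D. ?G v \<le> ?F v"
      using AE_revenue_le_first_price by eventually_elim (rule ennreal_leI)
  qed (use fin in \<open>auto simp: revenue_def\<close>)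
  also have "\<dots> = 0" using eq fin by simp
  finally have "AE v in value_profiles D. ?F v - ?G v = 0"
    by (subst (asm) nn_integral_0_iff_AE) auto
  with AE_revenue_le_first_price AE_bid_profiles[OF \<beta>(2)] show ?thesis
  proof eventually_elim
    case (elim v)
    have nonneg: "0 \<le> (\<Sum>i\<in>UNIV. pay N (\<beta> \<circ> v) i)"
      by (intro sum_nonneg single_item_auctionD(5)[OF N(1) elim(2)])
    then have "(\<Sum>i\<in>UNIV. pay N (\<beta> \<circ> v) i) = (\<Sum>i\<in>UNIV. pay (first_price :: 'i auction) (\<beta> \<circ> v) i)"
      using elim(1,3) by (simp add: ennreal_minus ennreal_eq_0_iff)
    also have "\<dots> = (\<Sum>i\<in>UNIV. alloc N (\<beta> \<circ> v) i * (\<beta> \<circ> v) i)"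
      using sum_alloc_bid_eq_Max[OF N(2,1) elim(2)]
        sum_alloc_bid_eq_Max[OF fp(2,1) elim(2)] by (simp add: pay_first_price)
    finally have "(\<Sum>i\<in>UNIV. alloc N (\<beta> \<circ> v) i * (\<beta> \<circ> v) i - pay N (\<beta> \<circ> v) i) = 0"
      by (simp add: sum_subtractf)
    then have "alloc N (\<beta> \<circ> v) i * (\<beta> \<circ> v) i - pay N (\<beta> \<circ> v) i = 0" for i
      using winner_pays_at_most_bidD[OF N(3) elim(2)]
      by (subst (asm) sum_nonneg_eq_0_iff) auto
    then show ?case by (simp add: algebra_simps)
  qed
qed

end

end

section \<open>Recovering bids from interim payments\<close>

context bidding
begin

lemma measurable_interim_alloc: "(\<lambda>t. X i (\<beta> t)) \<in> borel_measurable borel"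
proof -
  interpret V: prob_space "value_profiles D :: ('i \<Rightarrow> real) measure"
    by (rule prob_space_value_profiles)
  have "(\<lambda>x. alloc M (\<beta> \<circ> (\<lambda>(t, w). w(i := t)) x) i) \<in> borel_measurable (D \<Otimes>\<^sub>M value_profiles D)"
    by (rule measurable_compose[OF measurable_resample])
       (rule measurable_alloc[OF single_item bid_measurable])
  then have "(\<lambda>t. \<integral>w. alloc M (\<beta> \<circ> w(i := t)) i \<partial>value_profiles D) \<in> borel_measurable D"
    by (intro V.borel_measurable_lebesgue_integral) (simp add: split_beta')
  then show ?thesis
    by (simp add: resample_bids interim_alloc_def measurable_cong_sets[OF events_eq_borel refl])
qed

text \<open>Let \<open>A\<close> be the set of values with which no bidder ever wins. When all
  values lie in \<open>A\<close>, the item almost surely stays unsold, which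
  \<open>highest_bidder_wins\<close> excludes; by independence \<open>A\<close> itself must be
  null.\<close>

lemma AE_interim_alloc_pos:
  assumes "highest_bidder_wins M"
  shows "AE t in D. \<exists>i. 0 < X i (\<beta> t)"
proof -
  define A where "A = {t. \<forall>i. X i (\<beta> t) = 0}"
  have A [measurable]: "A \<in> sets borel"
    unfolding A_def using measurable_interim_alloc[measurable] by measurable
  \<comment> \<open>With the own value fixed in \<open>A\<close>, the allocation is nonnegative with
    integral 0 over the values of the others.\<close>
  have "AE v in value_profiles D. v i \<in> A \<longrightarrow> alloc M (\<beta> \<circ> v) i = 0" for i
  proof (rule AE_resampleD[where i=i])
    show "Measurable.pred (value_profiles D) (\<lambda>v. v i \<in> A \<longrightarrow> alloc M (\<beta> \<circ> v) i = 0)"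
      using measurable_alloc[OF single_item bid_measurable, of i, measurable] by measurable
    show "AE t in D. AE w in value_profiles D.
        (w(i := t)) i \<in> A \<longrightarrow> alloc M (\<beta> \<circ> w(i := t)) i = 0"
      using values_nonneg
    proof eventually_elim
      case (elim t)
      note t = bid_nonneg[OF elim]
      have "AE w in value_profiles D. alloc M ((\<beta> \<circ> w)(i := \<beta> t)) i = 0" if "t \<in> A"
      proof (subst integral_nonneg_eq_0_iff_AE[symmetric])
        show "AE w in value_profiles D. 0 \<le> alloc M ((\<beta> \<circ> w)(i := \<beta> t)) i"
          using AE_alloc_pay_upd_bounds[OF t, of i] by eventually_elim simp
      qed (use that integrable_alloc_upd[OF t] in \<open>auto simp: A_def interim_alloc_def\<close>)
      then show ?case by (cases "t \<in> A") (auto simp: resample_bids)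
    qed
  qed
  then have "AE v in value_profiles D. \<forall>i. v i \<in> A \<longrightarrow> alloc M (\<beta> \<circ> v) i = 0"
    unfolding AE_all_countable by (rule allI)
  with AE_bid_profiles[OF bids_nonneg]
  have "AE v in value_profiles D. v \<notin> {v. \<forall>i::'i. v i \<in> A}"
  proof eventually_elim
    case (elim v)
    then have "(\<Sum>i\<in>UNIV. alloc M (\<beta> \<circ> v) i) = 1"
      using assms by (simp add: highest_bidder_wins_def)
    moreover have "(\<Sum>i\<in>UNIV. alloc M (\<beta> \<circ> v) i) = 0" if "\<forall>i. v i \<in> A"
      using elim that by (intro sum.neutral) auto
    ultimately show ?case by auto
  qed
  then have "measure (value_profiles D) {v. \<forall>i::'i. v i \<in> A} = 0"
    by (rule measure_eq_0_null_sets[OF AE_iff_null_sets[THEN iffD2, rotated]])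
       (rule sets_all_components[OF A])
  then have "measure D A = 0"
    by (simp add: measure_all_components[OF A])
  then have "AE t in D. t \<notin> A"
    by (intro AE_not_in) (auto simp: null_sets_def emeasure_eq_measure)
  then show ?thesis
    using values_nonneg
  proof eventually_elim
    case (elim t)
    then obtain i where "X i (\<beta> t) \<noteq> 0" by (auto simp: A_def)
    then show ?case using interim_bounds(1)[OF bid_nonneg[OF elim(2)], of i] by (intro exI[of _ i]) simp
  qed
qed

text \<open>Once the own value is fixed, the own bid is a constant and leaves the integral.\<close>

lemma AE_interim_pay_eq_bid:
  assumes "AE v in value_profiles D. pay M (\<beta> \<circ> v) i = alloc M (\<beta> \<circ> v) i * \<beta> (v i)"
  shows "AE t in D. P i (\<beta> t) = X i (\<beta> t) * \<beta> t"
  using AE_resample[OF assms, of i] values_nonneg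
proof eventually_elim
  case (elim t)
  note t = bid_nonneg[OF elim(2)]
  have "P i (\<beta> t) = (\<integral>w. alloc M ((\<beta> \<circ> w)(i := \<beta> t)) i * \<beta> t \<partial>value_profiles D)"
    unfolding interim_pay_def
  proof (rule integral_cong_AE)
    show "AE w in value_profiles D.
        pay M ((\<beta> \<circ> w)(i := \<beta> t)) i = alloc M ((\<beta> \<circ> w)(i := \<beta> t)) i * \<beta> t"
      using elim(1) by eventually_elim (simp add: resample_bids)
  qed (use integrable_alloc_upd[OF t] integrable_pay_upd[OF t] in auto)
  then show ?case by (simp add: interim_alloc_def)
qed

end

text \<open>Both interim payments equal the bid times the common winning probability, and they agree
  by revenue equivalence. The probability can be cancelled for some bidder, who may depend on
  \<open>t\<close>; hence the quantifier over \<open>i\<close> inside the almost-sure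
  statement.\<close>

lemma (in two_equilibria) AE_same_bids:
  assumes wins: "highest_bidder_wins M"
    and "\<And>i. AE v in value_profiles D. pay M (\<beta> \<circ> v) i = alloc M (\<beta> \<circ> v) i * \<beta> (v i)"
    and "\<And>i. AE v in value_profiles D. pay M' (\<beta>' \<circ> v) i = alloc M' (\<beta>' \<circ> v) i * \<beta>' (v i)"
  shows "AE t in D. \<beta> t = \<beta>' t"
proof -
  have "AE t in D. \<forall>i. E.X i (\<beta> t) * \<beta> t = E.X i (\<beta> t) * \<beta>' t"
    unfolding AE_all_countable
  proof
    fix i
    show "AE t in D. E.X i (\<beta> t) * \<beta> t = E.X i (\<beta> t) * \<beta>' t"
      using E.AE_interim_pay_eq_bid[OF assms(2)[of i]] E'.AE_interim_pay_eq_bid[OF assms(3)[of i]]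
        AE_same_interim_alloc[of i] AE_same_interim_pay[of i]
      by eventually_elim metis
  qed
  with E.AE_interim_alloc_pos[OF wins] show ?thesis
  proof eventually_elim
    case (elim t)
    then obtain i where "0 < E.X i (\<beta> t)" "E.X i (\<beta> t) * \<beta> t = E.X i (\<beta> t) * \<beta>' t" by auto
    then show ?case by simp
  qed
qed

section \<open>Absence of atoms in first-price bids\<close>

lemma ex_other_element:
  assumes "2 \<le> CARD('a::finite)"
  shows "\<exists>k. k \<noteq> (i :: 'a)"
proof (rule ccontr)
  assume "\<not> ?thesis"
  then have "UNIV = {i}" by auto
  then have "CARD('a) = 1" by (metis is_singletonI is_singleton_altdef)
  with assms show False by simp
qed

text \<open>A bidder who ties with positive probability and whose value exceeds his bid profits from a
  slight overbid, which turns all ties into sure wins.\<close>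

lemma first_price_bids_no_atom:
  assumes eq: "equilibrium D (first_price :: 'i::finite auction) \<beta>" and n: "2 \<le> CARD('i)"
  shows "measure D {t. \<beta> t = b} = 0"
proof (rule ccontr)
  \<comment> \<open>The final contradiction in numbers: giving up a fraction \<open>q / 4\<close> of
    the margin costs less than the gain \<open>q / 2\<close> in winning probability.\<close>
  have overbid_gain: "Q - q / 2 < Q * (1 - q / 4)" if "Q \<le> 1" "0 < q" for Q q :: real
  proof -
    have "Q * q \<le> 1 * q" using that by (intro mult_right_mono) auto
    then show ?thesis using that(2) by (simp add: right_diff_distrib)
  qed
  assume pos: "measure D {t. \<beta> t = b} \<noteq> 0"
  interpret equilibrium D "first_price :: 'i auction" \<beta> by (rule eq)
  interpret V: prob_space "value_profiles D :: ('i \<Rightarrow> real) measure"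
    by (rule prob_space_value_profiles)
  define S where "S = {t. \<beta> t = b}"
  have S [measurable]: "S \<in> sets borel" unfolding S_def by measurable
  define i :: 'i where "i = undefined"
  obtain k where k: "k \<noteq> i"
    using ex_other_element[OF n] by blast
  \<comment> \<open>\<open>top\<close> is the event that no opponent of \<open>i\<close> bids above
    \<open>b\<close>. In \<open>tie\<close> all values bid \<open>b\<close>, including the
    irrelevant coordinate \<open>i\<close>, so that its probability is a power of
    \<open>measure D S\<close> and therefore positive.\<close>
  define top where "top = {w :: 'i \<Rightarrow> real. \<forall>k. k \<noteq> i \<longrightarrow> \<beta> (w k) \<le> b}"
  define tie where "tie = {w :: 'i \<Rightarrow> real. \<forall>k. w k \<in> S}"
  define Q where "Q = V.prob top"
  define q where "q = V.prob tie"
  have [measurable]: "top \<in> sets (value_profiles D)" "tie \<in> sets (value_profiles D)"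
  proof -
    have "{w \<in> space (value_profiles D). \<forall>k :: 'i. k \<noteq> i \<longrightarrow> \<beta> (w k) \<le> b} \<in> sets (value_profiles D)"
      by measurable
    then show "top \<in> sets (value_profiles D)" by (simp add: top_def)
    show "tie \<in> sets (value_profiles D)" unfolding tie_def by (rule sets_all_components[OF S])
  qed
  have "0 < measure D S" using pos by (simp add: S_def zero_less_measure_iff)
  then have q: "0 < q"
    by (simp add: q_def tie_def measure_all_components)
  have Q: "Q \<le> 1" by (simp add: Q_def)
  have "tie \<subseteq> top" by (auto simp: tie_def top_def S_def)
  have exS: "\<exists>t\<in>S. R t" if "AE t in D. R t" for R
  proof (rule ccontr)
    assume "\<not> ?thesis"
    then have "AE t in D. t \<notin> S" using that by auto
    then have "measure D S = 0"
      by (subst (asm) AE_iff_measurable[where N=S]) (auto simp: emeasure_eq_measure)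
    with \<open>0 < measure D S\<close> show False by simp
  qed
  obtain t0 where "t0 \<in> S" "0 \<le> t0" using exS[OF values_nonneg] by blast
  then have b: "0 \<le> b" using bid_nonneg[of t0] by (simp add: S_def)
  have integrable_ind: "integrable (value_profiles D) (\<lambda>w. indicator A w * (r::real))"
    if "A \<in> sets (value_profiles D)" for A :: "('i \<Rightarrow> real) set" and r
    using that by (intro integrable_mult_left integrable_real_indicator) (auto simp: V.emeasure_eq_measure)
  have pay: "P i c = X i c * c" for c
    by (simp add: interim_pay_def interim_alloc_def pay_first_price)
  have X_over: "Q \<le> X i c" if "b < c" for c
  proof -
    have "(\<integral>w. indicator top w * 1 \<partial>value_profiles D) \<le> X i c"
      unfolding interim_alloc_def
    proof (rule integral_mono_AE)
      show "AE w in value_profiles D.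
          indicator top w * 1 \<le> alloc (first_price :: 'i auction) ((\<beta> \<circ> w)(i := c)) i"
        using AE_alloc_pay_upd_bounds[OF order_trans[OF b less_imp_le[OF that]], of i]
      proof eventually_elim
        case (elim w)
        show ?case
        proof (cases "w \<in> top")
          case True
          then show ?thesis
            using that by (subst alloc_first_price_unique) (auto simp: top_def intro: le_less_trans)
        qed (use elim in simp)
      qed
    qed (use that b integrable_ind[of top 1] in \<open>auto intro!: integrable_alloc_upd\<close>)
    then show ?thesis by (simp add: Q_def)
  qed
  \<comment> \<open>On \<open>tie\<close> bidder \<open>i\<close> shares with \<open>k\<close> and
    gets at most one half; elsewhere on \<open>top\<close> at most 1; outside \<open>top\<close> he
    is outbid.\<close>
  have X_le: "X i b \<le> Q - q / 2"
  proof -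
    have "X i b \<le> (\<integral>w. indicator top w * 1 - indicator tie w * (1 / 2) \<partial>value_profiles D)"
      unfolding interim_alloc_def
    proof (rule integral_mono)
      fix w :: "'i \<Rightarrow> real"
      consider "w \<in> tie" | "w \<notin> tie" "w \<in> top" | "w \<notin> top" by blast
      then show "alloc (first_price :: 'i auction) ((\<beta> \<circ> w)(i := b)) i \<le>
          indicator top w * 1 - indicator tie w * (1 / 2)"
      proof cases
        case 1
        then show ?thesis
          using alloc_first_price_tied[OF k, of "(\<beta> \<circ> w)(i := b)"] k \<open>tie \<subseteq> top\<close>
          by (auto simp: tie_def S_def indicator_def top_def)
      next
        case 2
        then show ?thesis
          using alloc_first_price_le_1[of "(\<beta> \<circ> w)(i := b)" i] by (simp add: top_def)
      next
        case 3
        then obtain k where "k \<noteq> i" "b < \<beta> (w k)" by (auto simp: top_def)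
        then show ?thesis
          using 3 \<open>tie \<subseteq> top\<close> alloc_first_price_outbid[of "(\<beta> \<circ> w)(i := b)" i k]
          by (auto simp: indicator_def)
      qed
    qed (use b in \<open>auto intro!: integrable_ind integrable_alloc_upd Bochner_Integration.integrable_diff
        simp del: mult_1_right\<close>)
    also have "\<dots> = Q - q / 2"
      by (subst Bochner_Integration.integral_diff)
        (use integrable_ind[of top 1] integrable_ind[of tie "1 / 2"] in \<open>simp_all add: Q_def q_def\<close>)
    finally show ?thesis .
  qed
  \<comment> \<open>On \<open>tie\<close> the uniform tie-breaking leaves \<open>i\<close> a share
    of at least one over the number of bidders.\<close>
  have X_pos: "0 < X i b"
  proof -
    have "(\<integral>w. indicator tie w * (1 / real CARD('i)) \<partial>value_profiles D) \<le> X i b"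
      unfolding interim_alloc_def
    proof (rule integral_mono_AE)
      show "AE w in value_profiles D. indicator tie w * (1 / real CARD('i)) \<le>
          alloc (first_price :: 'i auction) ((\<beta> \<circ> w)(i := b)) i"
        using AE_alloc_pay_upd_bounds[OF b, of i]
      proof eventually_elim
        case (elim w)
        then show ?case
          using alloc_first_price_highest[of "(\<beta> \<circ> w)(i := b)" i]
          by (cases "w \<in> tie") (auto simp: tie_def S_def)
      qed
    qed (rule integrable_ind integrable_alloc_upd b \<open>tie \<in> sets (value_profiles D)\<close>)+
    then have "q * (1 / real CARD('i)) \<le> X i b" by (simp add: q_def)
    then show ?thesis using q by (auto intro: less_le_trans[rotated])
  qed
  have "AE t in D. t \<noteq> b"
    using no_atoms[of b] by (intro AE_I[where N="{b}"]) (auto simp: emeasure_eq_measure)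
  with values_nonneg have "AE t in D. 0 \<le> t \<and> t \<noteq> b" by eventually_elim simp
  \<comment> \<open>\<open>S\<close> has positive mass and the point \<open>b\<close> has none, so
    some value other than \<open>b\<close> bids \<open>b\<close>. Nonnegative utility then places it
    above \<open>b\<close>.\<close>
  from exS[OF this] obtain v where v: "\<beta> v = b" "0 \<le> v" "v \<noteq> b" by (auto simp: S_def)
  have "0 \<le> X i b * (v - b)"
    using utility_nonneg[OF v(2), of i] v(1) by (simp add: pay algebra_simps)
  then have vb: "b < v" using X_pos v(3) by (simp add: zero_le_mult_iff)
  have q1: "q \<le> 1" by (simp add: q_def)
  \<comment> \<open>The overbid sacrifices exactly the fraction \<open>q / 4\<close> of the margin
    \<open>v - b\<close>.\<close>
  define c where "c = b + (v - b) * (q / 4)"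
  have c: "b < c" "0 \<le> c" using vb q b by (auto simp: c_def)
  have vc: "v - c = (v - b) * (1 - q / 4)" by (simp add: c_def algebra_simps)
  have "(v - b) * (Q * (1 - q / 4)) = Q * (v - c)" by (simp add: vc)
  also have "\<dots> \<le> X i c * (v - c)"
    using X_over[OF c(1)] vb q1 by (intro mult_right_mono) (auto simp: vc)
  also have "\<dots> \<le> X i b * (v - b)"
    using deviation_le[OF v(2) c(2), of i] by (simp add: pay v(1) algebra_simps)
  also have "\<dots> \<le> (Q - q / 2) * (v - b)"
    using X_le vb by (intro mult_right_mono) auto
  finally have "Q * (1 - q / 4) \<le> Q - q / 2"
    using vb by (simp add: mult.commute)
  then show False using overbid_gain[OF Q q] by simp
qed

text \<open>With the value of one bidder fixed by resampling, the bid of another hits the same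
  number with probability 0; there are finitely many pairs.\<close>

lemma (in bidding) AE_inj_bids:
  assumes "\<And>b. measure D {t. \<beta> t = b} = 0"
  shows "AE v in value_profiles D. inj (\<beta> \<circ> (v :: 'i \<Rightarrow> real))"
proof -
  have "AE v in value_profiles D. i \<noteq> k \<longrightarrow> \<beta> (v i) \<noteq> \<beta> (v k)" for i k :: 'i
  proof (cases "i = k")
    case False
    show ?thesis
    proof (rule AE_resampleD[where i=i])
      have "AE s in D. \<beta> t \<noteq> \<beta> s" for t
      proof (rule AE_I[where N="{s. \<beta> s = \<beta> t}"])
        show "emeasure D {s. \<beta> s = \<beta> t} = 0" by (simp add: emeasure_eq_measure assms)
        have "{s \<in> space D. \<beta> s = \<beta> t} \<in> sets D" by measurable
        then show "{s. \<beta> s = \<beta> t} \<in> sets D" by simp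
      qed auto
      from AE_component[OF this, where i=k] False
      show "AE t in D. AE w in value_profiles D.
          i \<noteq> k \<longrightarrow> \<beta> ((w(i := t)) i) \<noteq> \<beta> ((w(i := t)) k)"
        by (intro AE_I2[of D]) simp
      show "Measurable.pred (value_profiles D) (\<lambda>v. i \<noteq> k \<longrightarrow> \<beta> (v i) \<noteq> \<beta> (v k))"
      proof -
        have "(\<lambda>v. \<beta> (v l)) \<in> borel_measurable (value_profiles D)" for l :: 'i by measurable
        then have "{v \<in> space (value_profiles D). \<beta> (v i) \<noteq> \<beta> (v k)} \<in> sets (value_profiles D)"
          by (intro borel_measurable_neq)
        then show ?thesis using False by (simp add: pred_def)
      qed
    qed
  qed simp
  then have "AE v in value_profiles D. \<forall>i k :: 'i. i \<noteq> k \<longrightarrow> \<beta> (v i) \<noteq> \<beta> (v k)"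
    unfolding AE_all_countable by (intro allI)
  then show ?thesis by eventually_elim (rule injI, metis comp_apply)
qed


section \<open>Weighted averages of revenues and the game between exchanges\<close>

text \<open>The deviations from \<open>T\<close> have one sign and weighted sum 0, and all weights
  are positive. Both signs occur below: lower bounds at a Nash equilibrium, upper bounds after a
  switch to first-price.\<close>

lemma weighted_average_eq:
  fixes lam a :: "'j::finite \<Rightarrow> real"
  assumes lam: "\<And>j. 0 < lam j" "(\<Sum>j\<in>UNIV. lam j) = 1" and avg: "(\<Sum>j\<in>UNIV. lam j * a j) = T"
    and "(\<forall>j. T \<le> a j) \<or> (\<forall>j. a j \<le> T)"
  shows "a j = T"
proof -
  have zero: "lam j * c j = 0" if "\<And>j. 0 \<le> c j" "(\<Sum>j\<in>UNIV. lam j * c j) = 0" for c :: "'j \<Rightarrow> real"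
    using that lam(1)[THEN less_imp_le] sum_nonneg_eq_0_iff[of UNIV "\<lambda>j. lam j * c j"] by simp
  have "(\<Sum>j\<in>UNIV. lam j * (a j - T)) = 0" "(\<Sum>j\<in>UNIV. lam j * (T - a j)) = 0"
    using avg lam(2) by (simp_all add: right_diff_distrib sum_subtractf sum_distrib_right[symmetric])
  then have "lam j * (a j - T) = 0 \<or> lam j * (T - a j) = 0"
    using assms(4) zero[of "\<lambda>j. a j - T"] zero[of "\<lambda>j. T - a j"] by force
  then show ?thesis using lam(1)[of j] by auto
qed

lemma weighted_average_bounds:
  fixes lam a :: "'j::finite \<Rightarrow> real"
  assumes "\<And>j. 0 < lam j" "(\<Sum>j\<in>UNIV. lam j) = 1"
  shows weighted_average_le: "(\<And>j. a j \<le> B) \<Longrightarrow> (\<Sum>j\<in>UNIV. lam j * a j) \<le> B"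
    and weighted_average_ge: "(\<And>j. B \<le> a j) \<Longrightarrow> B \<le> (\<Sum>j\<in>UNIV. lam j * a j)"
proof -
  have B: "(\<Sum>j\<in>UNIV. lam j * B) = B" using assms(2) by (simp add: sum_distrib_right[symmetric])
  show "(\<And>j. a j \<le> B) \<Longrightarrow> (\<Sum>j\<in>UNIV. lam j * a j) \<le> B"
    using assms(1)[THEN less_imp_le] by (subst B[symmetric]) (intro sum_mono mult_left_mono)
  show "(\<And>j. B \<le> a j) \<Longrightarrow> B \<le> (\<Sum>j\<in>UNIV. lam j * a j)"
    using assms(1)[THEN less_imp_le] by (subst B[symmetric]) (intro sum_mono mult_left_mono)
qed

theorem theorem3p1:
  fixes D :: "real measure" and f :: "real \<Rightarrow> real"
    and lam :: "'j::finite \<Rightarrow> real"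
    and C :: "('i::finite) auction set"
    and \<sigma> :: "('j \<Rightarrow> 'i auction) \<Rightarrow> real \<Rightarrow> real"
  assumes "CARD('i) \<ge> 2" and "CARD('j) \<ge> 2"
    and "value_distribution D f"
    and "\<And>j. 0 < lam j" and "(\<Sum>j\<in>UNIV. lam j) = 1"
    and "C \<subseteq> admissible_auctions D" and "first_price \<in> C"
    and "well_behaved_class D lam C"
    and "bidding_play D lam C \<sigma>"
    and "\<And>M j. range M \<subseteq> C \<Longrightarrow> revenue D (M j) (\<sigma> M) < \<infinity>"
  shows "exchange_NE D C \<sigma> (\<lambda>_. first_price) \<and>
    (\<forall>M. exchange_NE D C \<sigma> M \<longrightarrow> (\<forall>j. is_first_price_ae D (M j)))"
proof -
  interpret bidder_values D by (rule value_distribution_bidder_values) fact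
  let ?FP = "\<lambda>_ :: 'j. first_price :: 'i auction"
  note lam = assms(4,5)
  have lam0: "\<And>j. 0 \<le> lam j" using lam(1) by (rule less_imp_le)
  have adm: "single_item_auction N" "highest_bidder_wins N" "winner_pays_at_most_bid N"
    if "N \<in> C" for N
    using that assms(6) by (auto intro: admissible_auctionsD)
  have rangeD: "P j \<in> C" if "range P \<subseteq> C" for P :: "'j \<Rightarrow> 'i auction" and j using that by auto
  have range_FP: "range ?FP \<subseteq> C" using assms(7) by auto
  have range_upd: "range (P(j := N)) \<subseteq> C" if "range P \<subseteq> C" "N \<in> C"
    for P :: "'j \<Rightarrow> 'i auction" and j N using that by auto
  have avg_FP: "average lam ?FP = first_price" by (rule average_const[OF lam(2)])
  have eq: "equilibrium D (average lam P) \<beta>"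
    if "range P \<subseteq> C" "symmetric_BNE D (average lam P) \<beta>" for P \<beta>
    by (intro equilibriumI single_item_average winner_pays_at_most_bid_average adm rangeD that lam0 lam)
  have BNE_\<sigma>: "symmetric_BNE D (average lam P) (\<sigma> P)" if "range P \<subseteq> C" for P
    using assms(9) that by (simp add: bidding_play_def)
  have \<sigma>: "\<sigma> P \<in> borel_measurable borel" "\<forall>v\<ge>0. 0 \<le> \<sigma> P v" if "range P \<subseteq> C" for P
    using BNE_\<sigma>[OF that] by (simp_all add: symmetric_BNE_def)
  have two: "two_equilibria D first_price (average lam P) \<beta> \<beta>'"
    if "range P \<subseteq> C" "symmetric_BNE D (first_price :: 'i auction) \<beta>"
      "symmetric_BNE D (average lam P) \<beta>'" for P \<beta> \<beta>'
  proof (intro two_equilibria.intro two_equilibria_axioms.intro)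
    show "AE v in value_profiles D. alloc first_price (\<beta> \<circ> v) = alloc (average lam P) (\<beta>' \<circ> v)"
      using assms(8)[unfolded well_behaved_class_def, THEN conjunct2, rule_format, of ?FP P \<beta> \<beta>']
        range_FP that by (simp add: avg_FP)
    show "equilibrium D (first_price :: 'i auction) \<beta>"
      using eq[OF range_FP, of \<beta>] that(2) by (simp add: avg_FP)
  qed (rule eq[OF that(1,3)])

  \<comment> \<open>Finite revenues make the passage to real numbers lossless.\<close>
  define R where "R P j = enn2real (revenue D (P j) (\<sigma> P))" for P :: "'j \<Rightarrow> 'i auction" and j
  have rev: "revenue D (P j) (\<sigma> P) = ennreal (R P j)" if "range P \<subseteq> C" for P j
    using assms(10)[OF that, of j] by (simp add: R_def)
  have R0: "0 \<le> R P j" for P j by (simp add: R_def)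
  \<comment> \<open>The choice of \<open>undefined\<close> is immaterial: in \<open>?FP\<close> all
    exchanges propose the same auction and face the same bids.\<close>
  define T where "T = R ?FP undefined"
  have R_FP: "R ?FP j = T" for j by (simp add: R_def T_def)
  have total: "(\<Sum>j\<in>UNIV. lam j * R P j) = T" if P: "range P \<subseteq> C" for P
  proof -
    interpret two_equilibria D first_price "average lam P" "\<sigma> ?FP" "\<sigma> P"
      using two[OF P _ BNE_\<sigma>[OF P]] BNE_\<sigma>[OF range_FP] by (simp add: avg_FP)
    have "ennreal T = revenue D (average lam P) (\<sigma> P)"
      using same_revenue rev[OF range_FP] by (simp add: R_FP)
    also have "\<dots> = (\<Sum>j\<in>UNIV. ennreal (lam j) * ennreal (R P j))"
      by (subst revenue_average) (auto simp: adm rangeD[OF P] lam0 \<sigma>[OF P] rev[OF P])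
    also have "\<dots> = ennreal (\<Sum>j\<in>UNIV. lam j * R P j)"
      using lam0 R0 by (simp add: ennreal_mult[symmetric] sum_ennreal)
    finally show ?thesis using R0 lam0 by (simp add: T_def sum_nonneg)
  qed
  have fp_best: "R P k \<le> R P j" if P: "range P \<subseteq> C" and "P j = first_price" for P j k
    using revenue_le_first_price[of "P k" "\<sigma> P"] adm rangeD[OF P] assms(7) \<sigma>[OF P]
      rev[OF P, of k] rev[OF P, of j] that(2) R0 by simp
  have NE_iff: "exchange_NE D C \<sigma> P \<longleftrightarrow> (\<forall>j. \<forall>N\<in>C. R (P(j := N)) j \<le> R P j)"
    if P: "range P \<subseteq> C" for P
    using rev[OF P] rev[OF range_upd[OF P]] P
    by (simp add: exchange_NE_def not_less) (metis fun_upd_same R0 ennreal_le_iff)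

  have "exchange_NE D C \<sigma> ?FP"
    unfolding NE_iff[OF range_FP] R_FP
  proof (intro allI ballI)
    fix j N assume "N \<in> C"
    let ?P = "?FP(j := N)"
    have P: "range ?P \<subseteq> C" by (rule range_upd[OF range_FP]) fact
    have "R ?P j \<le> R ?P k" for k
      by (cases "k = j") (auto intro: fp_best[OF P])
    \<comment> \<open>The deviator earns no more than any of the first-price exchanges, hence no
      more than the average, which revenue equivalence keeps at \<open>T\<close>.\<close>
    from weighted_average_ge[OF lam, of "R ?P j" "R ?P", OF this] show "R ?P j \<le> T" by (simp only: total[OF P])
  qed
  moreover have "is_first_price_ae D (M k)" if NE: "exchange_NE D C \<sigma> M" for M k
  proof -
    have M: "range M \<subseteq> C" using NE by (simp add: exchange_NE_def)
    have P: "range (M(j := first_price)) \<subseteq> C" for j by (rule range_upd[OF M assms(7)])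
    \<comment> \<open>A first-price exchange is a top earner, so it earns at least the
      average.\<close>
    have ge: "T \<le> R (M(j := first_price)) j" for j
      using weighted_average_le[OF lam, of "R (M(j := first_price))" "R (M(j := first_price)) j"]
        fp_best[OF P, of j j] total[OF P, of j] by simp
    have le: "R (M(j := first_price)) j \<le> R M j" for j
      using NE assms(7) by (simp add: NE_iff[OF M])
    have "R M j = T" for j
      by (rule weighted_average_eq[OF lam total[OF M]]) (use ge le order_trans in blast)
    then have RP: "R (M(j := first_price)) j = T" for j using ge[of j] le[of j] by simp
    \<comment> \<open>A different exchange \<open>j\<close> switches to first-price, so that
      exchange \<open>k\<close> keeps \<open>M k\<close> and both are compared under the same
      bids.\<close>
    obtain j where j: "j \<noteq> k" using ex_other_element[OF assms(2)] by blast
    define P where "P = M(j := first_price)"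
    define \<beta>' where "\<beta>' = \<sigma> P"
    have P: "range P \<subseteq> C" "P j = first_price" "P k = M k"
      using P[of j] j by (auto simp: P_def)
    \<comment> \<open>The top earner \<open>j\<close> earns just the average \<open>T\<close>, so
      nobody earns less.\<close>
    have "R P l = T" for l
      by (rule weighted_average_eq[OF lam total[OF P(1)]])
        (use fp_best[OF P(1,2)] RP[of j, folded P_def] in simp)
    then have "revenue D (P l) \<beta>' = revenue D (first_price :: 'i auction) \<beta>'" for l
      using rev[OF P(1), of l] rev[OF P(1), of j] P(2) by (simp add: \<beta>'_def)
    then have pay: "AE v in value_profiles D. \<forall>i. pay (P l) (\<beta>' \<circ> v) i = alloc (P l) (\<beta>' \<circ> v) i * \<beta>' (v i)"
      for l
      unfolding \<beta>'_def
      by (intro AE_pay_eq_bid_if_revenue_eq adm rangeD[OF P(1)] assms(7) \<sigma>[OF P(1)] assms(10)[OF P(1)])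
    have pay_avg: "AE v in value_profiles D.
        pay (average lam P) (\<beta>' \<circ> v) i = alloc (average lam P) (\<beta>' \<circ> v) i * \<beta>' (v i)" for i
    proof -
      have "AE v in value_profiles D. \<forall>l. \<forall>i. pay (P l) (\<beta>' \<circ> v) i = alloc (P l) (\<beta>' \<circ> v) i * \<beta>' (v i)"
        by (rule AE_all_countable[THEN iffD2]) (intro allI pay)
      then show ?thesis
        by eventually_elim (simp add: average_def sum_distrib_right mult.assoc)
    qed
    show ?thesis
      unfolding is_first_price_ae_def
    proof (intro allI impI)
      fix \<beta> assume \<beta>: "symmetric_BNE D (first_price :: 'i auction) \<beta>"
      interpret two_equilibria D first_price "average lam P" \<beta> \<beta>'
        unfolding \<beta>'_def by (rule two[OF P(1) \<beta> BNE_\<sigma>[OF P(1)]])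
      have "AE t in D. \<beta> t = \<beta>' t"
        by (rule AE_same_bids) (use adm[OF assms(7)] pay_avg in \<open>auto simp: pay_first_price\<close>)
      from AE_all_components[OF this]
      have bids: "AE v in value_profiles D. \<beta> \<circ> v = \<beta>' \<circ> (v :: 'i \<Rightarrow> real)"
        by eventually_elim auto
      \<comment> \<open>Without ties the allocations are forced to agree; payments then agree
        because \<open>M k\<close> charges the winner his bid.\<close>
      have "AE v in value_profiles D. inj (\<beta> \<circ> (v :: 'i \<Rightarrow> real))"
        by (rule E.AE_inj_bids) (rule first_price_bids_no_atom[OF E.equilibrium_axioms assms(1)])
      with bids pay[of k] AE_bid_profiles[OF E.bids_nonneg]
      show "AE v in value_profiles D. alloc (M k) (\<beta> \<circ> v) = alloc first_price (\<beta> \<circ> v) \<and>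
          pay (M k) (\<beta> \<circ> v) = pay first_price (\<beta> \<circ> v)"
      proof eventually_elim
        case (elim v)
        have same: "\<beta>' (v i) = \<beta> (v i)" for i
          using fun_cong[OF elim(1), of i] by simp
        have "alloc (M k) (\<beta> \<circ> v) = alloc first_price (\<beta> \<circ> v)"
          by (rule highest_bidder_wins_alloc_unique)
            (use adm rangeD[OF M] assms(7) elim in auto)
        moreover from this have "pay (M k) (\<beta> \<circ> v) i = pay first_price (\<beta> \<circ> v) i" for i
          using elim(2) unfolding elim(1)[symmetric] P(3) by (simp add: pay_first_price same)
        ultimately show ?case by auto
      qed
    qed
  qed
  ultimately show ?thesis by blast
qed

end
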